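(* Let $d\ge 1$ and $n\ge d+2$. Then the graph $[n]^d$ is $L_n^d$-list-colorable, where $L_n^d:[n]^d\to\{2,\dots,d+2\}$ is defined by $L_n^d(\vec i)=2+|\{1\le k\le d : 1<i_k<n\}|$ for $\vec i=(i_1,\dots,i_d)$.
   Context: $[n]=\{1,\dots,n\}$, and $[n]^d$ denotes the induced subgraph of the lattice $\mathbb{Z}^d$ (vertices adjacent iff they differ by a standard unit vector) on the vertex set $\{1,\dots,n\}^d$. For a graph $G$ and $L:G\to\mathbb{N}$, $G$ is $L$-list-colorable if for every collection of sets $\{S_v\}_{v\in G}$ with $|S_v|\ge L(v)$ for all $v$, there is a proper coloring $f$ of $G$ (adjacent vertices get different colors) with $f(v)\in S_v$ for all $v$. *)

theory Defs
  imports Main "HOL-Library.FuncSet"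
begin

record 'v graph =
  verts :: "'v set"
  adj :: "'v \<Rightarrow> 'v \<Rightarrow> bool"

definition induced_subgraph :: "'v graph \<Rightarrow> 'v set \<Rightarrow> 'v graph" where
  "induced_subgraph G W =
     \<lparr>verts = verts G \<inter> W, adj = (\<lambda>u v. u \<in> W \<and> v \<in> W \<and> adj G u v)\<rparr>"

definition proper_coloring :: "'v graph \<Rightarrow> ('v \<Rightarrow> 'c) \<Rightarrow> bool" where
  "proper_coloring G f \<longleftrightarrow> (\<forall>u\<in>verts G. \<forall>v\<in>verts G. adj G u v \<longrightarrow> f u \<noteq> f v)"

text \<open>The colours range over an arbitrary type 'c. Infinite colour sets are
  allowed; they need separate treatment because \<^const>\<open>card\<close> is 0 on them.\<close>

definition list_colorable :: "'c itself \<Rightarrow> 'v graph \<Rightarrow> ('v \<Rightarrow> nat) \<Rightarrow> bool" where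
  "list_colorable (_ :: 'c itself) G L \<longleftrightarrow>
     (\<forall>S :: 'v \<Rightarrow> 'c set.
        (\<forall>v\<in>verts G. infinite (S v) \<or> card (S v) \<ge> L v) \<longrightarrow>
        (\<exists>f. proper_coloring G f \<and> (\<forall>v\<in>verts G. f v \<in> S v)))"

text \<open>Points of the d-dimensional integer lattice are functions on
  \<open>{1..d}\<close>, extended by \<^const>\<open>undefined\<close> outside that set; updating the
  k-th coordinate to its successor is adding the k-th standard unit vector.\<close>

definition lattice :: "nat \<Rightarrow> (nat \<Rightarrow> int) graph" where
  "lattice d =
     \<lparr>verts = {1..d} \<rightarrow>\<^sub>E UNIV,
      adj = (\<lambda>u v. u \<in> {1..d} \<rightarrow>\<^sub>E UNIV \<and> v \<in> {1..d} \<rightarrow>\<^sub>E UNIV \<and>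
               (\<exists>k\<in>{1..d}. v = u(k := u k + 1) \<or> u = v(k := v k + 1)))\<rparr>"

definition grid :: "nat \<Rightarrow> nat \<Rightarrow> (nat \<Rightarrow> int) graph" where
  "grid n d = induced_subgraph (lattice d) ({1..d} \<rightarrow>\<^sub>E {1..int n})"

definition grid_list_size :: "nat \<Rightarrow> nat \<Rightarrow> (nat \<Rightarrow> int) \<Rightarrow> nat" where
  "grid_list_size n d i = 2 + card {k \<in> {1..d}. 1 < i k \<and> i k < int n}"

end

theory Submission
  imports Defs
begin

text \<open>
  A bipartite digraph has a kernel in every induced subgraph, so the kernel method of Bondy, Boppana
  and Siegel colours it from any lists that are larger than the outdegrees. It remains to orient the
  grid so that a vertex with \<open>m\<close> interior coordinates has outdegree at most \<open>m + 1\<close>. Choose a pivot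
  on every axis-parallel line and direct the line away from it: a vertex then has one outgoing edge for
  each of its interior coordinates, and one more for each line on which it is the pivot. Taking as pivot
  of a line in direction \<open>k\<close> its vertex with coordinate sum congruent to \<open>k\<close> modulo \<open>n\<close>, every
  vertex is the pivot of at most one line, since \<open>d \<le> n\<close>.
\<close>

text \<open>If every vertex of \<open>W\<close> in \<open>A\<close> has an out-neighbour in
  \<open>W\<close>, that neighbour lies outside \<open>A\<close>, so \<open>W - A\<close> is a
  kernel. Otherwise some \<open>x\<close> is a sink of \<open>W\<close>: delete it with its
  in-neighbours, take a kernel of the rest, and add \<open>x\<close>.\<close>

lemma bipartite_kernel_exists:
  fixes R :: "'v \<Rightarrow> 'v \<Rightarrow> bool"
  assumes "finite W" and bip: "\<And>u v. R u v \<Longrightarrow> u \<in> A \<longleftrightarrow> v \<notin> A"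
  shows "\<exists>K\<subseteq>W. (\<forall>u\<in>K. \<forall>v\<in>K. \<not> R u v) \<and> (\<forall>u\<in>W - K. \<exists>v\<in>K. R u v)"
  using assms(1)
proof (induction W rule: finite_psubset_induct)
  case (psubset W)
  show ?case
  proof (cases "\<forall>u\<in>W \<inter> A. \<exists>v\<in>W. R u v")
    case True
    show ?thesis
      by (rule exI[of _ "W - A"]) (use True bip in blast)
  next
    case False
    then obtain x where x: "x \<in> W" "\<forall>v\<in>W. \<not> R x v"
      by blast
    define W' where "W' = {u\<in>W. u \<noteq> x \<and> \<not> R u x}"
    have "W' \<subset> W"
      using x unfolding W'_def by blast
    from psubset.IH[OF this] obtain K where K: "K \<subseteq> W'"
      "\<forall>u\<in>K. \<forall>v\<in>K. \<not> R u v" "\<forall>u\<in>W' - K. \<exists>v\<in>K. R u v"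
      by blast
    show ?thesis
    proof (intro exI[of _ "insert x K"] conjI)
      show "insert x K \<subseteq> W"
        using K(1) x(1) unfolding W'_def by blast
      show "\<forall>u\<in>insert x K. \<forall>v\<in>insert x K. \<not> R u v"
        using K(1,2) x unfolding W'_def by blast
      show "\<forall>u\<in>W - insert x K. \<exists>v\<in>insert x K. R u v"
        using K(3) unfolding W'_def by blast
    qed
  qed
qed

text \<open>Give one colour \<open>c\<close> to a kernel \<open>K\<close> of the vertices whose
  lists contain \<open>c\<close>, then delete \<open>K\<close> and \<open>c\<close>. A remaining
  vertex that loses \<open>c\<close> also loses an out-neighbour in \<open>K\<close>, so its list
  stays larger than its outdegree.\<close>

lemma bipartite_list_coloring:
  fixes R :: "'v \<Rightarrow> 'v \<Rightarrow> bool" and S :: "'v \<Rightarrow> 'c set"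
  assumes "finite V" and bip: "\<And>u v. R u v \<Longrightarrow> u \<in> A \<longleftrightarrow> v \<notin> A"
    and "\<And>v. v \<in> V \<Longrightarrow> card {u\<in>V. R v u} < card (S v)"
  shows "\<exists>f. (\<forall>v\<in>V. f v \<in> S v) \<and> (\<forall>u\<in>V. \<forall>v\<in>V. R u v \<longrightarrow> f u \<noteq> f v)"
  using assms(1,3)
proof (induction V arbitrary: S rule: finite_psubset_induct)
  case (psubset V)
  show ?case
  proof (cases "V = {}")
    case False
    then obtain x where x: "x \<in> V"
      by blast
    then have "S x \<noteq> {}"
      using psubset.prems[OF x] by auto
    then obtain c where c: "c \<in> S x"
      by blast
    define W where "W = {v\<in>V. c \<in> S v}"
    have "\<exists>K\<subseteq>W. (\<forall>u\<in>K. \<forall>v\<in>K. \<not> R u v) \<and> (\<forall>u\<in>W - K. \<exists>v\<in>K. R u v)"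
    proof (rule bipartite_kernel_exists[where A = A])
      show "finite W"
        using psubset.hyps unfolding W_def by simp
      show "u \<in> A \<longleftrightarrow> v \<notin> A" if "R u v" for u v
        using that by (rule bip)
    qed
    then obtain K where K: "K \<subseteq> W"
      "\<forall>u\<in>K. \<forall>v\<in>K. \<not> R u v" "\<forall>u\<in>W - K. \<exists>v\<in>K. R u v"
      by blast
    have "x \<in> W"
      using x c unfolding W_def by simp
    \<comment> \<open>If \<open>x\<close> is outside \<open>K\<close>, it has an out-neighbour in
      \<open>K\<close>; either way the induction descends.\<close>
    then have "K \<noteq> {}"
      using K(3) by blast
    moreover have "K \<subseteq> V"
      using K(1) unfolding W_def by blast
    ultimately have less: "V - K \<subset> V"
      by blast
    have deg: "card {u\<in>V - K. R v u} < card (S v - {c})" if v: "v \<in> V - K" for v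
    proof (cases "c \<in> S v")
      case True
      then obtain w where w: "w \<in> K" "R v w"
        using K(3) v unfolding W_def by blast
      have "card {u\<in>V - K. R v u} < card {u\<in>V. R v u}"
        by (rule psubset_card_mono) (use w \<open>K \<subseteq> V\<close> psubset.hyps in auto)
      moreover have "card {u\<in>V. R v u} < card (S v)"
        using psubset.prems v by blast
      ultimately show ?thesis
        using True by (simp add: card_Diff_singleton)
    next
      case False
      have "card {u\<in>V - K. R v u} \<le> card {u\<in>V. R v u}"
        by (rule card_mono) (use psubset.hyps in auto)
      also have "\<dots> < card (S v)"
        using psubset.prems v by blast
      finally show ?thesis
        using False by simp
    qed
    obtain f where f: "\<forall>v\<in>V - K. f v \<in> S v - {c}"
      "\<forall>u\<in>V - K. \<forall>v\<in>V - K. R u v \<longrightarrow> f u \<noteq> f v"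
      using psubset.IH[OF less, of "\<lambda>v. S v - {c}"] deg by blast
    show ?thesis
    proof (intro exI[of _ "\<lambda>v. if v \<in> K then c else f v"] conjI ballI impI)
      show "(if v \<in> K then c else f v) \<in> S v" if "v \<in> V" for v
        using that K(1) f(1) unfolding W_def by auto
      show "(if u \<in> K then c else f u) \<noteq> (if v \<in> K then c else f v)"
        if "u \<in> V" "v \<in> V" "R u v" for u v
        using that K(2) f by auto
    qed
  qed simp
qed

text \<open>The value of coordinate \<open>k\<close> that makes the total coordinate sum congruent
  to \<open>k\<close> modulo \<open>n\<close>. The shift by 1 turns the residues
  \<open>0..n-1\<close> into \<open>1..n\<close>. Omitting \<open>u k\<close> from the sum makes the
  value common to the whole line.\<close>

definition pivot :: "nat \<Rightarrow> nat \<Rightarrow> (nat \<Rightarrow> int) \<Rightarrow> nat \<Rightarrow> int" where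
  "pivot n d u k = 1 + (int k - 1 - (\<Sum>i\<in>{1..d} - {k}. u i)) mod int n"

text \<open>Both inequalities are weak, so that a pivot sends arcs both ways along its line.\<close>

definition arc :: "nat \<Rightarrow> nat \<Rightarrow> (nat \<Rightarrow> int) \<Rightarrow> (nat \<Rightarrow> int) \<Rightarrow> bool" where
  "arc n d u v \<longleftrightarrow>
     (\<exists>k\<in>{1..d}. (v = u(k := u k + 1) \<and> pivot n d u k \<le> u k) \<or>
                  (v = u(k := u k - 1) \<and> u k \<le> pivot n d u k))"

lemma pivot_fun_upd: "pivot n d (u(k := x)) k = pivot n d u k"
proof -
  have "(\<Sum>i\<in>{1..d} - {k}. (u(k := x)) i) = (\<Sum>i\<in>{1..d} - {k}. u i)"
    by (intro sum.cong) auto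
  then show ?thesis
    unfolding pivot_def by (simp only:)
qed

lemma pivot_range: "n > 0 \<Longrightarrow> 1 \<le> pivot n d u k \<and> pivot n d u k \<le> int n"
  unfolding pivot_def using pos_mod_sign[of "int n"] pos_mod_bound[of "int n"]
  by (smt (verit) of_nat_0_less_iff)

lemma pivot_eq_imp_dvd:
  assumes "u k = pivot n d u k" and k: "k \<in> {1..d}"
  shows "int n dvd (\<Sum>i\<in>{1..d}. u i) - int k"
proof -
  define r where "r = (\<Sum>i\<in>{1..d} - {k}. u i)"
  have "(\<Sum>i\<in>{1..d}. u i) = u k + r"
    unfolding r_def using k by (simp add: sum.remove)
  moreover have "u k - 1 = (int k - 1 - r) mod int n"
    using assms(1) unfolding pivot_def r_def by simp
  then have "int n dvd (int k - 1 - r) - (u k - 1)"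
    by (metis dvd_minus_mod)
  then have "int n dvd - ((int k - 1 - r) - (u k - 1))"
    by (simp only: dvd_minus_iff)
  ultimately show ?thesis
    by (simp add: algebra_simps)
qed

text \<open>Both \<open>k\<close> and \<open>l\<close> are congruent to the coordinate sum of
  \<open>u\<close> modulo \<open>n\<close>, and they differ by less than \<open>n\<close>.\<close>

lemma pivot_direction_unique:
  assumes "d \<le> n" "k \<in> {1..d}" "l \<in> {1..d}"
    and "u k = pivot n d u k" "u l = pivot n d u l"
  shows "k = l"
proof -
  have "int n dvd ((\<Sum>i\<in>{1..d}. u i) - int k) - ((\<Sum>i\<in>{1..d}. u i) - int l)"
    using assms by (intro dvd_diff pivot_eq_imp_dvd)
  then have "int n dvd int l - int k"
    by simp
  moreover have "\<bar>int l - int k\<bar> < int n"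
    using assms(1-3) by auto
  ultimately show ?thesis
    using dvd_imp_le_int[of "int l - int k" "int n"] by fastforce
qed

lemma arc_outdegree:
  assumes "0 < n" "d \<le> n" and u: "u \<in> {1..d} \<rightarrow>\<^sub>E {1..int n}"
  shows "card {v \<in> {1..d} \<rightarrow>\<^sub>E {1..int n}. arc n d u v}
           < 2 + card {k \<in> {1..d}. 1 < u k \<and> u k < int n}"
proof -
  define I where "I = {k \<in> {1..d}. 1 < u k \<and> u k < int n}"
  \<comment> \<open>The step away from the pivot; at the pivot itself, the downward one.\<close>
  define g where "g k = (if pivot n d u k < u k then u(k := u k + 1) else u(k := u k - 1))" for k
  \<comment> \<open>If \<open>u\<close> is the pivot of no line, \<open>l\<close> is arbitrary and
    \<open>e\<close> below is merely a spare element of the bounding set.\<close>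
  define l where "l = (SOME k. k \<in> {1..d} \<and> u k = pivot n d u k)"
  \<comment> \<open>The upward step at a pivot, complementing \<open>g l\<close>. If
    \<open>u l\<close> is \<open>n\<close>, only the downward step can stay in the grid, and
    \<open>l\<close> is not in \<open>I\<close>, so \<open>e\<close> must cover it.\<close>
  define e where "e = (if u l < int n then u(l := u l + 1) else u(l := u l - 1))"
  have "v \<in> insert e (g ` I)" if v: "v \<in> {1..d} \<rightarrow>\<^sub>E {1..int n}" and "arc n d u v" for v
  proof -
    obtain k where k: "k \<in> {1..d}"
      and kv: "(v = u(k := u k + 1) \<and> pivot n d u k \<le> u k) \<or>
               (v = u(k := u k - 1) \<and> u k \<le> pivot n d u k)"
      using \<open>arc n d u v\<close> unfolding arc_def by blast
    have vk: "1 \<le> v k" "v k \<le> int n" and uk: "1 \<le> u k" "u k \<le> int n"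
      using PiE_mem[OF v k] PiE_mem[OF u k] by auto
    have p: "1 \<le> pivot n d u k" "pivot n d u k \<le> int n"
      using pivot_range[OF \<open>0 < n\<close>] by auto
    show ?thesis
    proof (cases "u k = pivot n d u k")
      case True
      have "l \<in> {1..d} \<and> u l = pivot n d u l"
        unfolding l_def by (rule someI[of _ k]) (use k True in blast)
      then have "l = k"
        using pivot_direction_unique[OF \<open>d \<le> n\<close> _ k] True by blast
      have "v = e \<or> (v = g k \<and> k \<in> I)"
        using kv vk uk True k unfolding e_def g_def I_def \<open>l = k\<close> by auto
      then show ?thesis
        by blast
    next
      case False
      \<comment> \<open>The pivot bounds \<open>u k\<close> strictly on one side, and
        \<open>v\<close>, a step further away but still in the grid, bounds it on the other; hence
        \<open>k\<close> is an interior direction.\<close>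
      then have "v = g k \<and> k \<in> I"
        using kv vk uk k p unfolding g_def I_def by auto
      then show ?thesis
        by blast
    qed
  qed
  then have "card {v \<in> {1..d} \<rightarrow>\<^sub>E {1..int n}. arc n d u v} \<le> card (insert e (g ` I))"
    by (intro card_mono) (auto simp: I_def)
  also have "\<dots> \<le> Suc (card (g ` I))"
    by (rule card_insert_le_m1) simp_all
  also have "\<dots> \<le> Suc (card I)"
    by (simp add: card_image_le I_def)
  finally show ?thesis
    unfolding I_def by simp
qed

lemma arc_changes_parity:
  assumes "arc n d u v"
  shows "even (\<Sum>i\<in>{1..d}. u i) \<longleftrightarrow> odd (\<Sum>i\<in>{1..d}. v i)"
proof -
  obtain k where k: "k \<in> {1..d}" and v: "v = u(k := u k + 1) \<or> v = u(k := u k - 1)"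
    using assms unfolding arc_def by blast
  have "(\<Sum>i\<in>{1..d}. w i) = w k + (\<Sum>i\<in>{1..d} - {k}. w i)" for w :: "nat \<Rightarrow> int"
    using k by (simp add: sum.remove)
  moreover have "(\<Sum>i\<in>{1..d} - {k}. v i) = (\<Sum>i\<in>{1..d} - {k}. u i)"
    using v by (intro sum.cong) auto
  ultimately show ?thesis
    using v by auto
qed

lemma grid_verts: "verts (grid n d) = {1..d} \<rightarrow>\<^sub>E {1..int n}"
  unfolding grid_def induced_subgraph_def lattice_def by (simp add: PiE_Int Int_absorb1 PiE_mono)

lemma arc_if_grid_adj:
  assumes "adj (grid n d) u v"
  shows "arc n d u v \<or> arc n d v u"
proof -
  have step: "arc n d u v \<or> arc n d v u" if "k \<in> {1..d}" "v = u(k := u k + 1)" for u v k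
  proof (cases "pivot n d u k \<le> u k")
    case True
    then show ?thesis
      using that unfolding arc_def by blast
  next
    case False
    \<comment> \<open>Both ends share the pivot of their line, and \<open>u k\<close> strictly below
      it gives \<open>u k + 1\<close> at most the pivot.\<close>
    then have "v k \<le> pivot n d v k" "u = v(k := v k - 1)"
      using that(2) by (auto simp: pivot_fun_upd)
    then show ?thesis
      using that(1) unfolding arc_def by blast
  qed
  from assms obtain k where "k \<in> {1..d}" "v = u(k := u k + 1) \<or> u = v(k := v k + 1)"
    unfolding grid_def induced_subgraph_def lattice_def by auto
  then show ?thesis
    using step[of k v u] step[of k u v] by argo
qed

theorem theorem1p2:
  fixes d n :: nat
  assumes "d \<ge> 1" and "n \<ge> d + 2"
  shows "list_colorable TYPE('c) (grid n d) (grid_list_size n d)"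
  unfolding list_colorable_def
proof (intro allI impI)
  fix S :: "(nat \<Rightarrow> int) \<Rightarrow> 'c set"
  let ?V = "verts (grid n d)"
  assume S: "\<forall>v\<in>?V. infinite (S v) \<or> grid_list_size n d v \<le> card (S v)"
  \<comment> \<open>Trimming the lists to their exact sizes disposes of infinite lists, to which the
    strict \<open>card\<close> bound of the colouring lemma cannot apply.\<close>
  have "\<exists>T\<subseteq>S v. card T = grid_list_size n d v" if "v \<in> ?V" for v
    using S that by (meson infinite_arbitrarily_large obtain_subset_with_card_n)
  then obtain T where T: "\<And>v. v \<in> ?V \<Longrightarrow> T v \<subseteq> S v \<and> card (T v) = grid_list_size n d v"
    by metis
  have "\<exists>f. (\<forall>v\<in>?V. f v \<in> T v) \<and> (\<forall>u\<in>?V. \<forall>v\<in>?V. arc n d u v \<longrightarrow> f u \<noteq> f v)"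
  proof (rule bipartite_list_coloring[where A = "{u. even (\<Sum>i\<in>{1..d}. u i)}"])
    show "finite ?V"
      by (simp add: grid_verts finite_PiE)
    show "u \<in> {u. even (\<Sum>i\<in>{1..d}. u i)} \<longleftrightarrow> v \<notin> {u. even (\<Sum>i\<in>{1..d}. u i)}"
      if "arc n d u v" for u v
      using arc_changes_parity[OF that] by simp
    show "card {u \<in> ?V. arc n d v u} < card (T v)" if "v \<in> ?V" for v
      using that T[OF that] arc_outdegree[of n d v] assms
      by (simp add: grid_verts grid_list_size_def)
  qed
  then obtain f where f: "\<forall>v\<in>?V. f v \<in> T v"
    "\<forall>u\<in>?V. \<forall>v\<in>?V. arc n d u v \<longrightarrow> f u \<noteq> f v"
    by blast
  have "proper_coloring (grid n d) f"
    unfolding proper_coloring_def using f(2) arc_if_grid_adj by metis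
  then show "\<exists>f. proper_coloring (grid n d) f \<and> (\<forall>v\<in>?V. f v \<in> S v)"
    using f(1) T by blast
qed

end
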